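(* Let $\mathcal O\subseteq\mathbb C$ be a subring containing $1$ and let $P,Q\in\mathrm{PCF}(\mathcal O)$ with $P\sim Q$. Then $P$ is quasiconvergent if and only if $Q$ is quasiconvergent. If $P$ and $Q$ both converge, then their limits are equal: $\hat P=\hat Q$.
   Context: A periodic continued fraction over $\mathcal O$ of type $(N,k)$ ($N\ge0,k\ge1$), $P=[b_1,\dots,b_N,\overline{a_1,\dots,a_k}]$ with $b_i,a_i\in\mathcal O$, has partial quotients $c_1,c_2,\dots$ equal to $b_1,\dots,b_N,a_1,\dots,a_k,a_1,\dots,a_k,\dots$; $\mathrm{PCF}(\mathcal O)$ is the set of these (with their types). Let $D(x)=\begin{bmatrix}x&1\\1&0\end{bmatrix}$, $M_n(P)=D(c_1)\cdots D(c_n)$; the convergents are $\mathcal C_n(P)=M_n(P)_{11}/M_n(P)_{21}\in\mathbb P^1(\mathbb C)$; $P$ converges to $\hat P$ if $\mathcal C_n(P)\to\hat P$ in $\mathbb P^1(\mathbb C)$. Let $E(P)=BAB^{-1}$ with $B=D(b_1)\cdots D(b_N)$, $A=D(a_1)\cdots D(a_k)$. For a $2\times2$ matrix $M=(m_{ij})$ let $\mathrm{Quad}(M)=m_{21}X^2+(m_{22}-m_{11})X-m_{12}$, with roots counted in $\mathbb P^1(\mathbb C)$ (degree drop counts as roots at $\infty$). $P$ is quasiconvergent if either $\mathrm{Quad}(E(P))\ne0$ has a single root in $\mathbb P^1(\mathbb C)$ of multiplicity $2$, or the two eigenvalues of $E(P)$ have different absolute values. Equivalence: on finite words over $\mathcal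 O$, $\sim$ is generated by $u[x,0,y]v\sim u[x+y]v$ ($u,v$ words, $x,y\in\mathcal O$). For a PCF $P$ set $\mathsf{SF}(P)=[b_1,\dots,b_N,a_1,\dots,a_k,0,-b_N,\dots,-b_1,0]$ if $N>0$ and $[a_1,\dots,a_k]$ if $N=0$; then $P\sim Q$ means $\mathsf{SF}(P)\sim\mathsf{SF}(Q)$. *)

theory Defs
  imports "HOL-Analysis.Analysis" "HOL-Computational_Algebra.Polynomial"
begin

definition unital_subring :: "complex set \<Rightarrow> bool" where
  "unital_subring R \<longleftrightarrow>
     1 \<in> R \<and> (\<forall>x\<in>R. \<forall>y\<in>R. x - y \<in> R) \<and> (\<forall>x\<in>R. \<forall>y\<in>R. x * y \<in> R)"


subsection \<open>Periodic continued fractions\<close>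

text \<open>
  \<open>Pcf bs as\<close> is \<open>[b\<^sub>1, \<dots>, b\<^sub>N, a\<^sub>1, \<dots>, a\<^sub>k, a\<^sub>1, \<dots>, a\<^sub>k, \<dots>]\<close> as formal data, that is, the type
  \<open>(N, k)\<close> with \<open>N = length bs\<close>, \<open>k = length as\<close> is part of the object: the same sequence of
  partial quotients can come from several values of this datatype.
\<close>

datatype pcf = Pcf (initial: "complex list") (period: "complex list")

definition PCF :: "complex set \<Rightarrow> pcf set" where
  "PCF R = {P. set (initial P) \<subseteq> R \<and> set (period P) \<subseteq> R \<and> period P \<noteq> []}"

text \<open>The partial quotients \<open>c\<^sub>1, c\<^sub>2, \<dots>\<close> are numbered from 1; the value at 0 is irrelevant.\<close>

definition partial_quotient :: "pcf \<Rightarrow> nat \<Rightarrow> complex" where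
  "partial_quotient P n =
     (if n \<le> length (initial P) then initial P ! (n - 1)
      else period P ! ((n - 1 - length (initial P)) mod length (period P)))"

definition D :: "complex \<Rightarrow> complex^2^2" where
  "D x = vector [vector [x, 1], vector [1, 0]]"

definition D_word :: "complex list \<Rightarrow> complex^2^2" where
  "D_word xs = foldr (\<lambda>x M. D x ** M) xs (mat 1)"

definition M :: "pcf \<Rightarrow> nat \<Rightarrow> complex^2^2" where
  "M P n = D_word (map (partial_quotient P) [1..<Suc n])"

definition E :: "pcf \<Rightarrow> complex^2^2" where
  "E P = D_word (initial P) ** D_word (period P) ** matrix_inv (D_word (initial P))"


subsection \<open>Convergence in the projective line\<close>

text \<open>
  \<open>\<complex>P\<^sup>1\<close> is the one-point compactification of \<open>\<complex>\<close>: \<open>Some z\<close> is the point \<open>[z : 1]\<close> and \<open>None\<close> is the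
  point \<open>\<infinity> = [1 : 0]\<close>.
\<close>

type_synonym P1 = "complex option"

abbreviation P1_topology :: "P1 topology" where
  "P1_topology \<equiv> Alexandroff_compactification euclidean"

text \<open>The point \<open>[p : q]\<close>; only meaningful for \<open>(p, q) \<noteq> (0, 0)\<close>.\<close>

definition P1_point :: "complex \<Rightarrow> complex \<Rightarrow> P1" where
  "P1_point p q = (if q = 0 then None else Some (p / q))"

text \<open>Since \<open>det (M P n) = \<plusminus>1\<close>, the first column of \<open>M P n\<close> never vanishes.\<close>

definition convergent_of :: "pcf \<Rightarrow> nat \<Rightarrow> P1" where
  "convergent_of P n = P1_point (M P n $ 1 $ 1) (M P n $ 2 $ 1)"

definition converges_to :: "pcf \<Rightarrow> P1 \<Rightarrow> bool" where
  "converges_to P l \<longleftrightarrow> limitin P1_topology (convergent_of P) l sequentially"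


subsection \<open>Quasiconvergence\<close>

definition Quad :: "complex^2^2 \<Rightarrow> complex poly" where
  "Quad A = [: - (A $ 1 $ 2), A $ 2 $ 2 - A $ 1 $ 1, A $ 2 $ 1 :]"

text \<open>
  Multiplicity of a point of \<open>\<complex>P\<^sup>1\<close> as a root of a nonzero polynomial of degree at most 2, viewed as
  a binary quadratic form: each drop of the degree below 2 counts as a root at \<open>\<infinity>\<close>.
\<close>

fun quadratic_root_mult :: "complex poly \<Rightarrow> P1 \<Rightarrow> nat" where
  "quadratic_root_mult q (Some z) = order z q"
| "quadratic_root_mult q None = 2 - degree q"

definition has_single_double_root :: "complex poly \<Rightarrow> bool" where
  "has_single_double_root q \<longleftrightarrow>
     (\<exists>r. {s. quadratic_root_mult q s > 0} = {r} \<and> quadratic_root_mult q r = 2)"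

definition is_eigenvalue :: "complex^2^2 \<Rightarrow> complex \<Rightarrow> bool" where
  "is_eigenvalue A l \<longleftrightarrow> (\<exists>v. v \<noteq> 0 \<and> A *v v = l *s v)"

definition quasiconvergent :: "pcf \<Rightarrow> bool" where
  "quasiconvergent P \<longleftrightarrow>
     (Quad (E P) \<noteq> 0 \<and> has_single_double_root (Quad (E P))) \<or>
     (\<exists>l m. is_eigenvalue (E P) l \<and> is_eigenvalue (E P) m \<and> cmod l \<noteq> cmod m)"


subsection \<open>Equivalence\<close>

inductive word_step :: "complex set \<Rightarrow> complex list \<Rightarrow> complex list \<Rightarrow> bool"
  for R :: "complex set" where
  "\<lbrakk>u \<in> lists R; v \<in> lists R; x \<in> R; y \<in> R\<rbrakk>
     \<Longrightarrow> word_step R (u @ [x, 0, y] @ v) (u @ [x + y] @ v)"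

definition word_equiv :: "complex set \<Rightarrow> complex list \<Rightarrow> complex list \<Rightarrow> bool" where
  "word_equiv R = equivclp (word_step R)"

definition SF :: "pcf \<Rightarrow> complex list" where
  "SF P = (if initial P = [] then period P
           else initial P @ period P @ [0] @ map uminus (rev (initial P)) @ [0])"

definition pcf_equiv :: "complex set \<Rightarrow> pcf \<Rightarrow> pcf \<Rightarrow> bool" where
  "pcf_equiv R P Q \<longleftrightarrow> word_equiv R (SF P) (SF Q)"

end

theory Submission
  imports Defs
begin

text \<open>
  The relation \<open>D x ** D 0 ** D y = D (x + y)\<close> makes \<open>D_word\<close> invariant under word equivalence, and
  \<open>D 0 ** D (- x) ** D 0\<close> is inverse to \<open>D x\<close>, so \<open>E P = D_word (SF P)\<close> depends only on the
  equivalence class of \<open>P\<close>; hence so does quasiconvergence. For the limits, both columns of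
  \<open>M P n\<close> represent convergents, so along the multiples of the period the limit \<open>p\<close> attracts two
  linearly independent orbits of \<open>E P\<close>. Therefore \<open>p\<close> is fixed by \<open>E P\<close>, and its eigenvalue
  strictly dominates in absolute value that of any other fixed point. If \<open>E P = E Q\<close> and the limits
  differed, each eigenvalue would strictly dominate the other.
\<close>

subsection \<open>Word equivalence and the matrix of the standard form\<close>

lemma matrix_2_eqI:
  fixes A B :: "'a^2^2"
  assumes "A$1$1 = B$1$1" "A$1$2 = B$1$2" "A$2$1 = B$2$1" "A$2$2 = B$2$2"
  shows "A = B"
  using assms by (simp add: vec_eq_iff forall_2)

lemma D_nth [simp]: "D x $ 1 $ 1 = x" "D x $ 1 $ 2 = 1" "D x $ 2 $ 1 = 1" "D x $ 2 $ 2 = 0"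
  by (simp_all add: D_def)

lemma matrix_mult_2_nth:
  fixes A :: "'a::semiring_1^2^'n" and B :: "'a^'m^2"
  shows "(A ** B) $ i $ j = A$i$1 * B$1$j + A$i$2 * B$2$j"
  by (simp add: matrix_matrix_mult_def sum_2)

lemma mat_1_2_nth: "(mat 1 :: 'a::zero_neq_one^2^2) $ 1 $ 1 = 1" "(mat 1 :: 'a^2^2) $ 1 $ 2 = 0"
  "(mat 1 :: 'a^2^2) $ 2 $ 1 = 0" "(mat 1 :: 'a^2^2) $ 2 $ 2 = 1"
  by (simp_all add: mat_def)

lemma D_mult_D_0_mult_D: "D x ** D 0 ** D y = D (x + y)"
  by (rule matrix_2_eqI) (simp_all add: matrix_mult_2_nth)

lemma D_0_mult_D_0: "D 0 ** D 0 = mat 1"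
  by (rule matrix_2_eqI) (simp_all add: matrix_mult_2_nth mat_1_2_nth)

lemma D_word_Nil [simp]: "D_word [] = mat 1"
  by (simp add: D_word_def)

lemma D_word_Cons [simp]: "D_word (x # xs) = D x ** D_word xs"
  by (simp add: D_word_def)

lemma D_word_append: "D_word (xs @ ys) = D_word xs ** D_word ys"
  by (induction xs) (simp_all add: matrix_mul_assoc)

lemma word_step_D_word: "word_step R xs ys \<Longrightarrow> D_word xs = D_word ys"
  by (induction rule: word_step.induct)
    (simp add: D_word_append D_mult_D_0_mult_D[symmetric] matrix_mul_assoc)

lemma word_equiv_D_word: "word_equiv R xs ys \<Longrightarrow> D_word xs = D_word ys"
  unfolding word_equiv_def
  by (induction rule: equivclp_induct) (auto dest: word_step_D_word)

text \<open>Inverting a product reverses the factors \<open>D 0 ** D (- x) ** D 0\<close>; adjacent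
  pairs \<open>D 0 ** D 0\<close> cancel, so zeros survive only at the two ends.\<close>

lemma D_word_mult_reversed:
  "D_word xs ** D_word ([0] @ map uminus (rev xs) @ [0]) = mat 1"
proof (induction xs)
  case Nil
  show ?case by (simp add: D_0_mult_D_0)
next
  case (Cons x xs)
  have "D_word (x # xs) ** D_word ([0] @ map uminus (rev (x # xs)) @ [0]) =
      D x ** (D_word xs ** (D 0 ** D_word (map uminus (rev xs)) ** (D 0 ** D 0) ** D (- x) ** D 0))"
    by (simp add: D_word_append matrix_mul_assoc D_0_mult_D_0)
  also have "\<dots> = D x ** (D_word xs ** D_word ([0] @ map uminus (rev xs) @ [0])) ** D 0 ** D (- x) ** D 0"
    by (simp add: D_word_append matrix_mul_assoc)
  also have "\<dots> = mat 1"
    unfolding Cons by (simp add: D_mult_D_0_mult_D D_0_mult_D_0)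
  finally show ?case .
qed

text \<open>\<open>matrix_inv\<close> is a choice; over a field a one-sided inverse of a square
  matrix is two-sided, and two-sided inverses are unique.\<close>

lemma matrix_inv_eqI:
  fixes A B :: "'a::field^'n^'n"
  assumes "A ** B = mat 1"
  shows "matrix_inv A = B"
proof -
  have "B ** A = mat 1"
    by (rule iffD1[OF matrix_left_right_inverse assms])
  then have "A ** matrix_inv A = mat 1 \<and> matrix_inv A ** A = mat 1"
    unfolding matrix_inv_def
    using assms someI[of "\<lambda>A'. A ** A' = mat 1 \<and> A' ** A = mat 1" B] by simp
  then show ?thesis
    using \<open>B ** A = mat 1\<close> by (metis matrix_mul_assoc matrix_mul_lid matrix_mul_rid)
qed

lemma matrix_inv_D_word: "matrix_inv (D_word xs) = D_word ([0] @ map uminus (rev xs) @ [0])"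
  by (rule matrix_inv_eqI) (rule D_word_mult_reversed)

lemma E_eq_D_word_SF: "E P = D_word (SF P)"
proof (cases "initial P = []")
  case True
  then show ?thesis
    \<comment> \<open>For N = 0 the inverse is given by the word [0, 0], whose matrix is the
      identity.\<close>
    using matrix_inv_D_word[of "[]"] by (simp add: E_def SF_def D_0_mult_D_0)
next
  case False
  then show ?thesis
    unfolding E_def matrix_inv_D_word SF_def by (simp only: if_False D_word_append matrix_mul_assoc)
qed

lemma pcf_equiv_E_eq: "pcf_equiv R P Q \<Longrightarrow> E P = E Q"
  unfolding pcf_equiv_def E_eq_D_word_SF by (rule word_equiv_D_word)

lemma E_mult_initial: "E P ** D_word (initial P) = D_word (initial P) ** D_word (period P)"
proof -
  have "matrix_inv (D_word (initial P)) ** D_word (initial P) = mat 1"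
    unfolding matrix_inv_D_word by (rule iffD1[OF matrix_left_right_inverse D_word_mult_reversed])
  then show ?thesis
    unfolding E_def by (metis matrix_mul_assoc matrix_mul_rid)
qed

lemma det_D_word_nonzero: "det (D_word xs) \<noteq> 0"
proof (induction xs)
  case (Cons x xs)
  have "det (D x) = -1" by (simp add: det_2)
  then show ?case using Cons by (simp add: det_mul)
qed simp


subsection \<open>Attracting directions of a linear map of the plane\<close>

text \<open>The determinant with columns \<open>v\<close>, \<open>w\<close>: zero exactly when they
  are dependent.\<close>

definition cross2 :: "complex^2 \<Rightarrow> complex^2 \<Rightarrow> complex" where
  "cross2 v w = v$1 * w$2 - v$2 * w$1"

lemma matrix_vector_mult_2_nth:
  fixes A :: "'a::semiring_1^2^'n"
  shows "(A *v x) $ i = A$i$1 * x$1 + A$i$2 * x$2"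
  by (simp add: matrix_vector_mult_def sum_2)

lemma cross2_scale_left: "cross2 (c *s v) w = c * cross2 v w"
  by (simp add: cross2_def algebra_simps)

lemma cross2_commute: "cross2 w v = - cross2 v w"
  by (simp add: cross2_def algebra_simps)

lemma tendsto_cross2:
  assumes "(f \<longlongrightarrow> v) F" "(g \<longlongrightarrow> w) F"
  shows "((\<lambda>x. cross2 (f x) (g x)) \<longlongrightarrow> cross2 v w) F"
  unfolding cross2_def by (intro tendsto_intros assms)

lemma cross2_eq_0D:
  assumes "cross2 v w = 0" "w \<noteq> 0"
  obtains l where "v = l *s w"
proof (cases "w$1 = 0")
  case True
  then have "w$2 \<noteq> 0" using assms(2) by (auto simp: vec_eq_iff forall_2)
  then have "v = (v$2 / w$2) *s w"
    using assms(1) True by (simp add: vec_eq_iff forall_2 cross2_def)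
  then show ?thesis by (rule that)
next
  case False
  then have "v = (v$1 / w$1) *s w"
    using assms(1) by (simp add: vec_eq_iff forall_2 cross2_def field_simps)
  then show ?thesis by (rule that)
qed

text \<open>Acting as a derivation on the one-dimensional second exterior power, \<open>A\<close> is
  multiplication by its trace.\<close>

lemma cross2_matrix_trace:
  "cross2 (A *v v) w + cross2 v (A *v w) = (A$1$1 + A$2$2) * cross2 v w"
  by (simp add: cross2_def matrix_vector_mult_2_nth algebra_simps)

text \<open>Pairing with \<open>w\<close> kills the \<open>w\<close> component, so only the
  eigenvalue \<open>m\<close> of the other eigenvector remains; the trace is
  \<open>l + m\<close>.\<close>

lemma cross2_eigenvector:
  assumes "A *v w = l *s w" "A *v w' = m *s w'" "cross2 w w' \<noteq> 0"
  shows "cross2 (A *v v) w = m * cross2 v w"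
proof -
  have scale_right: "cross2 x (c *s y) = c * cross2 x y" for x y c
    by (simp add: cross2_def algebra_simps)
  have "(l + m) * cross2 w w' = (A$1$1 + A$2$2) * cross2 w w'"
    using cross2_matrix_trace[of A w w'] assms(1,2)
    by (simp add: cross2_scale_left scale_right algebra_simps)
  then have "A$1$1 + A$2$2 = l + m" using assms(3) by simp
  then show ?thesis
    using cross2_matrix_trace[of A v w] assms(1)
    by (simp add: scale_right algebra_simps)
qed

lemma cross2_orbit:
  assumes "\<And>n. v (Suc n) = A *v v n"
    and "A *v w = l *s w" "A *v w' = m *s w'" "cross2 w w' \<noteq> 0"
  shows "cross2 (v n) w = m ^ n * cross2 (v 0) w"
  by (induction n) (simp_all add: assms(1) cross2_eigenvector[OF assms(2-4)])

text \<open>\<open>A\<close> sends each rescaled orbit vector to a multiple of the next one whenever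
  the latter is nonzero. Parallelism is a closed condition, so it passes to the limit.\<close>

lemma orbit_limit_eigenvector:
  fixes A :: "complex^2^2"
  assumes orbit: "\<And>n. v (Suc n) = A *v v n"
    and lim: "(\<lambda>n. c n *s v n) \<longlonglongrightarrow> w" and "w \<noteq> 0"
  obtains l where "A *v w = l *s w"
proof -
  have "(\<lambda>n. A *v (c n *s v n)) \<longlonglongrightarrow> A *v w"
  proof (rule vec_tendstoI)
    fix i
    show "(\<lambda>n. (A *v (c n *s v n)) $ i) \<longlonglongrightarrow> (A *v w) $ i"
      unfolding matrix_vector_mult_2_nth by (intro tendsto_intros lim)
  qed
  moreover have "(\<lambda>n. c (Suc n) *s v (Suc n)) \<longlonglongrightarrow> w"
    using lim by (rule LIMSEQ_Suc)
  ultimately have "(\<lambda>n. cross2 (A *v (c n *s v n)) (c (Suc n) *s v (Suc n))) \<longlonglongrightarrow> cross2 (A *v w) w"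
    by (rule tendsto_cross2)
  moreover have "cross2 (A *v (c n *s v n)) (c (Suc n) *s v (Suc n)) = 0" for n
    by (simp add: orbit vector_scalar_commute cross2_def)
  ultimately have "cross2 (A *v w) w = 0"
    by (simp add: LIMSEQ_const_iff)
  then show ?thesis
    using \<open>w \<noteq> 0\<close> that by (rule cross2_eq_0D)
qed

text \<open>After rescaling, the component along \<open>w\<close>, of size \<open>l ^ n\<close>, has
  a nonzero limit, while the one along \<open>w'\<close>, of size \<open>m ^ n\<close> and not
  initially zero, tends to 0.\<close>

lemma orbit_limit_dominates:
  assumes orbit: "\<And>n. v (Suc n) = A *v v n"
    and lim: "(\<lambda>n. c n *s v n) \<longlonglongrightarrow> w"
    and w: "A *v w = l *s w" and w': "A *v w' = m *s w'" and ww': "cross2 w w' \<noteq> 0"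
    and v0: "cross2 (v 0) w \<noteq> 0"
  shows "cmod m < cmod l"
proof (rule ccontr)
  assume "\<not> cmod m < cmod l"
  then have le: "cmod l ^ n \<le> cmod m ^ n" for n by (simp add: power_mono)
  define s t where "s = cross2 (v 0) w'" and "t = cross2 (v 0) w"
  have w'w: "cross2 w' w \<noteq> 0"
    using ww' cross2_commute[of w w'] by simp
  have s: "cross2 (v n) w' = l ^ n * s" for n
    unfolding s_def by (rule cross2_orbit[where v = v, OF orbit w' w w'w])
  have t: "cross2 (v n) w = m ^ n * t" for n
    unfolding t_def by (rule cross2_orbit[where v = v, OF orbit w w' ww'])
  have lim_s: "(\<lambda>n. c n * (l ^ n * s)) \<longlonglongrightarrow> cross2 w w'"
    using tendsto_cross2[OF lim tendsto_const, of w'] by (simp add: cross2_scale_left s)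
  have "(\<lambda>n. c n * (m ^ n * t)) \<longlonglongrightarrow> cross2 w w"
    using tendsto_cross2[OF lim tendsto_const, of w] by (simp add: cross2_scale_left t)
  then have "(\<lambda>n. c n * (m ^ n * t)) \<longlonglongrightarrow> 0"
    by (simp add: cross2_def mult.commute)
  \<comment> \<open>The factor \<open>s / t\<close> makes the null sequence a majorant of the
    \<open>w\<close> component when \<open>cmod l \<le> cmod m\<close>.\<close>
  then have "(\<lambda>n. (s / t) * (c n * (m ^ n * t))) \<longlonglongrightarrow> 0"
    by (rule tendsto_mult_right_zero)
  then have "(\<lambda>n. c n * (l ^ n * s)) \<longlonglongrightarrow> 0"
  proof (rule Lim_null_comparison[rotated, OF tendsto_norm_zero])
    have "cmod (c n * (l ^ n * s)) \<le> cmod ((s / t) * (c n * (m ^ n * t)))" for n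
    proof -
      have "cmod (c n * (l ^ n * s)) = (cmod (c n) * cmod s) * cmod l ^ n"
        by (simp add: norm_mult norm_power)
      also have "\<dots> \<le> (cmod (c n) * cmod s) * cmod m ^ n"
        by (intro mult_left_mono le) simp
      also have "\<dots> = cmod ((s / t) * (c n * (m ^ n * t)))"
        using v0 by (simp add: t_def norm_mult norm_power norm_divide)
      finally show ?thesis .
    qed
    then show "\<forall>\<^sub>F n in sequentially.
        cmod (c n * (l ^ n * s)) \<le> cmod ((s / t) * (c n * (m ^ n * t)))"
      by simp
  qed
  then show False using LIMSEQ_unique[OF lim_s] ww' by blast
qed


subsection \<open>Limits of convergents\<close>

fun P1_vector :: "P1 \<Rightarrow> complex^2" where
  "P1_vector (Some z) = vector [z, 1]"
| "P1_vector None = vector [1, 0]"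

lemma P1_vector_nonzero: "P1_vector p \<noteq> 0"
  by (cases p) (auto simp: vec_eq_iff forall_2)

lemma cross2_P1_vector: "p \<noteq> q \<Longrightarrow> cross2 (P1_vector p) (P1_vector q) \<noteq> 0"
  by (cases p; cases q) (auto simp: cross2_def)

lemma tendsto_vec_2:
  fixes f :: "'b \<Rightarrow> 'a::topological_space^2"
  assumes "((\<lambda>x. f x $ 1) \<longlongrightarrow> a $ 1) F" "((\<lambda>x. f x $ 2) \<longlongrightarrow> a $ 2) F"
  shows "(f \<longlongrightarrow> a) F"
proof (rule vec_tendstoI)
  fix i :: 2
  show "((\<lambda>x. f x $ i) \<longlongrightarrow> a $ i) F"
    using exhaust_2[of i] assms by auto
qed

text \<open>Divide by a coordinate that is eventually nonzero: the second near a finite point, the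
  first near infinity. Zero vectors must be excluded because \<open>P1_point\<close> sends them to
  infinity.\<close>

lemma limitin_P1_rescale:
  assumes lim: "limitin P1_topology (\<lambda>n. P1_point (v n $ 1) (v n $ 2)) p F"
    and nz: "\<And>n. v n \<noteq> 0"
  obtains c where "((\<lambda>n. c n *s v n) \<longlongrightarrow> P1_vector p) F"
proof (cases p)
  case (Some z)
  have near: "\<forall>\<^sub>F n in F. v n $ 2 \<noteq> 0 \<and> v n $ 1 / v n $ 2 \<in> U" if "open U" "z \<in> U" for U
  proof -
    have "\<forall>\<^sub>F n in F. P1_point (v n $ 1) (v n $ 2) \<in> Some ` U"
      using lim that by (auto simp: limitin_def Some)
    then show ?thesis
      by eventually_elim (auto simp: P1_point_def split: if_splits)
  qed
  have "((\<lambda>n. v n $ 1 / v n $ 2) \<longlongrightarrow> z) F"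
    by (rule topological_tendstoI) (rule eventually_mono[OF near], auto)
  moreover have "((\<lambda>n. inverse (v n $ 2) * v n $ 2) \<longlongrightarrow> 1) F"
  proof (rule tendsto_eventually)
    show "\<forall>\<^sub>F n in F. inverse (v n $ 2) * v n $ 2 = 1"
      by (rule eventually_mono[OF near[of UNIV]]) auto
  qed
  ultimately have "((\<lambda>n. inverse (v n $ 2) *s v n) \<longlongrightarrow> P1_vector p) F"
    by (intro tendsto_vec_2) (simp_all add: Some divide_inverse mult.commute)
  then show ?thesis by (rule that)
next
  case None
  have near: "\<forall>\<^sub>F n in F. v n $ 2 = 0 \<or> cmod (v n $ 1 / v n $ 2) > K" for K
  proof -
    have "openin P1_topology (insert None (Some ` (UNIV - cball 0 K)))"
      unfolding openin_Alexandroff_compactification by (rule disjI2) (rule exI[of _ "cball 0 K"], simp)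
    then have "\<forall>\<^sub>F n in F. P1_point (v n $ 1) (v n $ 2) \<in> insert None (Some ` (UNIV - cball 0 K))"
      using lim by (auto simp: limitin_def None)
    then show ?thesis
      by eventually_elim (auto simp: P1_point_def split: if_splits)
  qed
  \<comment> \<open>The bound with K = 0 already excludes a vanishing first coordinate unless both
    vanish.\<close>
  have nz1: "\<forall>\<^sub>F n in F. v n $ 1 \<noteq> 0"
    using near[of 0]
  proof eventually_elim
    case (elim n)
    then show ?case using nz[of n] by (auto simp: vec_eq_iff forall_2)
  qed
  have "((\<lambda>n. v n $ 2 / v n $ 1) \<longlongrightarrow> 0) F"
  proof (rule tendstoI)
    fix e :: real assume "e > 0"
    show "\<forall>\<^sub>F n in F. dist (v n $ 2 / v n $ 1) 0 < e"
      using near[of "1 / e"] nz1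
    proof eventually_elim
      case (elim n)
      then show ?case
        using \<open>e > 0\<close> by (cases "v n $ 2 = 0") (auto simp: norm_divide field_simps)
    qed
  qed
  moreover have "((\<lambda>n. inverse (v n $ 1) * v n $ 1) \<longlongrightarrow> 1) F"
    by (rule tendsto_eventually) (rule eventually_mono[OF nz1], simp)
  ultimately have "((\<lambda>n. inverse (v n $ 1) *s v n) \<longlongrightarrow> P1_vector p) F"
    by (intro tendsto_vec_2) (simp_all add: None divide_inverse mult.commute)
  then show ?thesis by (rule that)
qed

section \<open>Convergent matrices along whole periods\<close>

lemma M_Suc: "M P (Suc n) = M P n ** D (partial_quotient P (Suc n))"
  by (simp add: M_def D_word_append)

lemma det_M_nonzero: "det (M P n) \<noteq> 0"
  unfolding M_def by (rule det_D_word_nonzero)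

lemma M_length_initial: "M P (length (initial P)) = D_word (initial P)"
proof -
  have "map (partial_quotient P) [1..<Suc (length (initial P))] = initial P"
    by (rule nth_equalityI) (simp_all del: upt_Suc add: partial_quotient_def)
  then show ?thesis by (simp only: M_def)
qed

lemma M_add_period:
  "M P (length (initial P) + n * length (period P) + length (period P)) =
    M P (length (initial P) + n * length (period P)) ** D_word (period P)"
proof -
  let ?m = "length (initial P) + n * length (period P)"
  have "[1..<Suc (?m + length (period P))] = [1..<Suc ?m] @ [Suc ?m..<Suc ?m + length (period P)]"
    using upt_add_eq_append[of 1 "Suc ?m" "length (period P)"] by simp
  moreover have "map (partial_quotient P) [Suc ?m..<Suc ?m + length (period P)] = period P"
    by (rule nth_equalityI) (auto simp del: upt_Suc simp: partial_quotient_def)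
  ultimately show ?thesis
    by (simp only: M_def map_append D_word_append)
qed

text \<open>Since B A^n = (B A B^-1)^n B, appending a period on the right is multiplication by
  \<open>E P\<close> on the left, so columns move along orbits of \<open>E P\<close>.\<close>

lemma M_add_period_E:
  "M P (length (initial P) + Suc n * length (period P)) =
    E P ** M P (length (initial P) + n * length (period P))"
proof (induction n)
  case 0
  show ?case
    using M_add_period[of P 0] by (simp add: M_length_initial E_mult_initial)
next
  case (Suc n)
  have "M P (length (initial P) + Suc (Suc n) * length (period P)) =
      M P (length (initial P) + Suc n * length (period P)) ** D_word (period P)"
    using M_add_period[of P "Suc n"] by (simp add: algebra_simps)
  also have "\<dots> = E P ** (M P (length (initial P) + n * length (period P)) ** D_word (period P))"
    unfolding Suc by (simp add: matrix_mul_assoc)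
  also have "\<dots> = E P ** M P (length (initial P) + Suc n * length (period P))"
    using M_add_period[of P n] by (simp add: algebra_simps)
  finally show ?case .
qed

lemma column_nonzero:
  fixes A :: "'a::field^'n^'n"
  assumes "det A \<noteq> 0"
  shows "column i A \<noteq> 0"
  using assms det_zero_column(2)[of i A] by metis

text \<open>This describes the limit through \<open>E P\<close> alone, which allows comparison of
  continued fractions of different types.\<close>

lemma pcf_limit_attracting:
  assumes "period P \<noteq> []" and conv: "converges_to P p"
  obtains l where "E P *v P1_vector p = l *s P1_vector p"
    and "\<And>w m. E P *v w = m *s w \<Longrightarrow> cross2 (P1_vector p) w \<noteq> 0 \<Longrightarrow> cmod m < cmod l"
proof -
  \<comment> \<open>Columns 1 and 2 of \<open>M P (Suc (r n))\<close> represent convergents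
    \<open>Suc (r n)\<close> and \<open>r n\<close>. Using \<open>Suc n\<close> periods keeps the
    subtraction from truncating.\<close>
  define r where "r n = length (initial P) + Suc n * length (period P) - 1" for n
  have Suc_r: "Suc (r n) = length (initial P) + Suc n * length (period P)" for n
    using assms(1) by (simp add: r_def)
  have r: "strict_mono r"
    unfolding strict_mono_Suc_iff
  proof
    fix n
    have "Suc (r n) < Suc (r (Suc n))"
      unfolding Suc_r using assms(1) by simp
    then show "r n < r (Suc n)" by simp
  qed
  define u where "u j n = column j (M P (Suc (r n)))" for j n
  have orbit: "u j (Suc n) = E P *v u j n" for j n
    unfolding u_def Suc_r M_add_period_E[of P "Suc n"]
    by (simp add: vec_eq_iff column_def matrix_mult_2_nth matrix_vector_mult_2_nth)
  have nz: "u j n \<noteq> 0" for j n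
    unfolding u_def by (intro column_nonzero det_M_nonzero)
  have lim: "limitin P1_topology (\<lambda>n. convergent_of P (f n)) p sequentially" if "strict_mono f" for f
    using limitin_subsequence[OF that] conv by (simp add: converges_to_def o_def)
  have "limitin P1_topology (\<lambda>n. P1_point (u j n $ 1) (u j n $ 2)) p sequentially" for j :: 2
  proof (cases "j = 1")
    case True
    have "strict_mono (\<lambda>n. Suc (r n))"
      using r by (simp add: strict_mono_def)
    from lim[OF this] show ?thesis
      by (simp add: True u_def column_def convergent_of_def)
  next
    case False
    then have "j = 2" using exhaust_2 by blast
    \<comment> \<open>The last factor \<open>D c\<close> moves the previous first column into second
      place.\<close>
    from lim[OF r] show ?thesis
      by (simp add: \<open>j = 2\<close> u_def column_def convergent_of_def M_Suc matrix_mult_2_nth)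
  qed
  then have "\<exists>c. (\<lambda>n. c n *s u j n) \<longlonglongrightarrow> P1_vector p" for j
    using limitin_P1_rescale[of "u j" p sequentially] nz by blast
  then obtain c where c: "(\<lambda>n. c j n *s u j n) \<longlonglongrightarrow> P1_vector p" for j
    using choice[of "\<lambda>j c. (\<lambda>n. c n *s u j n) \<longlonglongrightarrow> P1_vector p"] by blast
  obtain l where l: "E P *v P1_vector p = l *s P1_vector p"
    using orbit_limit_eigenvector[of "u 1", OF orbit c P1_vector_nonzero] .
  \<comment> \<open>The columns of an invertible matrix cannot both lie on the line of
    \<open>p\<close>; take one that does not.\<close>
  obtain j where j: "cross2 (u j 0) (P1_vector p) \<noteq> 0"
  proof (rule ccontr)
    assume "\<not> thesis"
    then have "cross2 (u j 0) (P1_vector p) = 0" for j using that by blast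
    then have "\<exists>a. u j 0 = a *s P1_vector p" for j
      using cross2_eq_0D[OF _ P1_vector_nonzero, of "u j 0"] by blast
    then obtain a where a: "u j 0 = a j *s P1_vector p" for j
      using choice[of "\<lambda>j a. u j 0 = a *s P1_vector p"] by blast
    have "det (M P (Suc (r 0))) = cross2 (u 1 0) (u 2 0)"
      by (simp add: det_2 u_def column_def cross2_def)
    also have "\<dots> = 0"
      unfolding a by (simp add: cross2_def)
    finally show False using det_M_nonzero by blast
  qed
  show ?thesis
    by (rule that[OF l]) (rule orbit_limit_dominates[where v = "u j", OF orbit c l _ _ j])
qed

theorem theorem7p6:
  fixes R :: "complex set" and P Q :: pcf
  assumes "unital_subring R"
    and "P \<in> PCF R" and "Q \<in> PCF R"
    and "pcf_equiv R P Q"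
  shows "(quasiconvergent P \<longleftrightarrow> quasiconvergent Q) \<and>
    (\<forall>p q. converges_to P p \<and> converges_to Q q \<longrightarrow> p = q)"
proof (intro conjI allI impI)
  have E: "E P = E Q"
    using assms(4) by (rule pcf_equiv_E_eq)
  then show "quasiconvergent P \<longleftrightarrow> quasiconvergent Q"
    by (simp add: quasiconvergent_def)
  fix p q
  assume pq: "converges_to P p \<and> converges_to Q q"
  have "period P \<noteq> []" "period Q \<noteq> []"
    using assms(2,3) by (auto simp: PCF_def)
  obtain l where l: "E P *v P1_vector p = l *s P1_vector p"
    "\<And>w k. E P *v w = k *s w \<Longrightarrow> cross2 (P1_vector p) w \<noteq> 0 \<Longrightarrow> cmod k < cmod l"
    using pcf_limit_attracting[OF \<open>period P \<noteq> []\<close>] pq by blast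
  obtain m where m: "E Q *v P1_vector q = m *s P1_vector q"
    "\<And>w k. E Q *v w = k *s w \<Longrightarrow> cross2 (P1_vector q) w \<noteq> 0 \<Longrightarrow> cmod k < cmod m"
    using pcf_limit_attracting[OF \<open>period Q \<noteq> []\<close>] pq by blast
  show "p = q"
  proof (rule ccontr)
    assume "p \<noteq> q"
    \<comment> \<open>Distinct points have independent representatives, so each limit competes with
      the other as an eigenvector of the common matrix.\<close>
    then have "cmod m < cmod l"
      using l(2)[of "P1_vector q" m] m(1) E cross2_P1_vector by simp
    moreover have "cmod l < cmod m"
      using m(2)[of "P1_vector p" l] l(1) E cross2_P1_vector \<open>p \<noteq> q\<close> by simp
    ultimately show False by simp
  qed
qed

end
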